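(* Let $x_0, x_1, x_2, \ldots$ be parameters (formal variables, or complex numbers) with $x_0 \neq 0$, and let $x(t) = \sum_{n\ge 0} x_n \frac{t^n}{n!}$. For $n \geq 1$ let \[ p_n = \sum_{T} \prod_{v \in V(T)} x_{\deg^+_T(v)}, \] the sum over all increasing trees $T$ on $n$ vertices, where $\deg^+_T(v)$ is the number of children of $v$ in $T$. For $s \geq 0$ define \[ b_s = \frac{1}{x_0} \sum_{k=0}^{s} \frac{k!}{(-x_0)^k}\, B_{s,k}(x_1, x_2, \ldots, x_{s-k+1}). \] Then for every $n \geq 1$, \[ p_n = x_0^{\,n} \sum_{k=0}^{n} (-x_0)^k\, B_{n+k-1,k}(0, b_1, b_2, \ldots, b_{n-1}). \]
   Context: An increasing tree on $n$ vertices is a rooted tree whose vertex set is $\{1,\ldots,n\}$ (children of a vertex are unordered) such that labels strictly increase along every path from the root to a leaf. Equivalently, $P(t)=\sum_{n\ge1} p_n \frac{t^n}{n!}$ is the degree-sequence generating function of increasing trees, satisfying $P'(t) = x(P(t))$, $P(0)=0$. Bell polynomials: for integers $n,k \geq 0$, $B_{n,k}(y_1,y_2,\ldots,y_{n-k+1}) = \sum_{\alpha} \frac{n!}{\alpha_1!\cdots\alpha_{n-k+1}!}\prod_{i}\left(\frac{y_i}{i!}\right)^{\alpha_i}$, the sum over all sequences $\alpha$ of nonnegative integers with $\sum_i \alpha_i = k$ and $\sum_i i\,\alpha_i = n$; in particular $B_{0,0}=1$ and $B_{n,0}=0$ for $n\ge1$. Extra arguments beyond those needed are ignored. *)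

theory Defs
  imports Complex_Main
begin

text \<open>A rooted tree is given by its root and the set \<open>E\<close> of its (parent, child) pairs.
  Children of a vertex thus carry no order.\<close>

definition walk :: "('v \<times> 'v) set \<Rightarrow> 'v list \<Rightarrow> bool" where
  "walk E p \<longleftrightarrow> p \<noteq> [] \<and> successively (\<lambda>u v. (u, v) \<in> E) p"

definition rooted_tree :: "'v set \<Rightarrow> 'v \<Rightarrow> ('v \<times> 'v) set \<Rightarrow> bool" where
  "rooted_tree V r E \<longleftrightarrow> r \<in> V \<and> E \<subseteq> V \<times> V \<and>
     (\<forall>v\<in>V. \<exists>!p. walk E p \<and> hd p = r \<and> last p = v)"

definition children :: "('v \<times> 'v) set \<Rightarrow> 'v \<Rightarrow> 'v set" where
  "children E v = {w. (v, w) \<in> E}"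

definition increasing_tree :: "nat \<Rightarrow> nat \<Rightarrow> (nat \<times> nat) set \<Rightarrow> bool" where
  "increasing_tree n r E \<longleftrightarrow> rooted_tree {1..n} r E \<and>
     (\<forall>p. walk E p \<and> hd p = r \<and> children E (last p) = {} \<longrightarrow> sorted_wrt (<) p)"

definition tree_sum :: "(nat \<Rightarrow> 'a::comm_semiring_1) \<Rightarrow> nat \<Rightarrow> 'a" where
  "tree_sum x n = (\<Sum>(r, E) \<in> {(r, E). increasing_tree n r E}. \<Prod>v\<in>{1..n}. x (card (children E v)))"

text \<open>Sequences are indexed by all of \<open>nat\<close> and vanish outside \<open>{1..n+1-k}\<close>, which is empty
  for \<open>k > n\<close>.\<close>

definition bell_index :: "nat \<Rightarrow> nat \<Rightarrow> (nat \<Rightarrow> nat) set" where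
  "bell_index n k = {\<alpha>. (\<forall>i. i \<notin> {1..n+1-k} \<longrightarrow> \<alpha> i = 0) \<and>
     (\<Sum>i\<in>{1..n+1-k}. \<alpha> i) = k \<and> (\<Sum>i\<in>{1..n+1-k}. i * \<alpha> i) = n}"

definition bell :: "nat \<Rightarrow> nat \<Rightarrow> (nat \<Rightarrow> 'a::field_char_0) \<Rightarrow> 'a" where
  "bell n k y = (\<Sum>\<alpha>\<in>bell_index n k.
     fact n / (\<Prod>i\<in>{1..n+1-k}. fact (\<alpha> i)) * (\<Prod>i\<in>{1..n+1-k}. (y i / fact i) ^ \<alpha> i))"

definition b_coeff :: "(nat \<Rightarrow> 'a::field_char_0) \<Rightarrow> nat \<Rightarrow> 'a" where
  "b_coeff x s = 1 / x 0 * (\<Sum>k\<in>{0..s}. fact k / (- x 0) ^ k * bell s k x)"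

text \<open>Both index sets are finite, so neither sum degenerates to \<open>0\<close> by convention.\<close>

lemma finite_increasing_trees: "finite {(r, E). increasing_tree n r E}"
  by (rule finite_subset[of _ "{1..n} \<times> Pow ({1..n} \<times> {1..n})"])
     (auto simp: increasing_tree_def rooted_tree_def)

lemma finite_bell_index: "finite (bell_index n k)"
proof (rule finite_subset)
  show "bell_index n k \<subseteq> {f. \<forall>i. (i \<in> {1..n+1-k} \<longrightarrow> f i \<in> {..k}) \<and> (i \<notin> {1..n+1-k} \<longrightarrow> f i = 0)}"
  proof
    fix \<alpha> assume a: "\<alpha> \<in> bell_index n k"
    have "\<alpha> i \<le> k" if "i \<in> {1..n+1-k}" for i
      using a member_le_sum[OF that, of \<alpha>] by (simp add: bell_index_def)
    then show "\<alpha> \<in> {f. \<forall>i. (i \<in> {1..n+1-k} \<longrightarrow> f i \<in> {..k}) \<and> (i \<notin> {1..n+1-k} \<longrightarrow> f i = 0)}"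
      using a by (simp add: bell_index_def)
  qed
  show "finite {f. \<forall>i. (i \<in> {1..n+1-k} \<longrightarrow> f i \<in> {..k}) \<and> (i \<notin> {1..n+1-k} \<longrightarrow> f i = (0::nat))}"
    by (rule finite_set_of_finite_funs) auto
qed

end

theory Submission
  imports Defs "HOL-Computational_Algebra.Formal_Laurent_Series"
begin

text \<open>
  Deleting the largest label shows that an increasing tree on \<open>n + 1\<close> vertices is an increasing tree
  on \<open>n\<close> vertices with a leaf attached to some vertex. Evaluate the tree sums at the iterated
  derivatives of a power series \<open>A\<close> instead of at numbers: attaching a leaf in all possible ways is
  then the Leibniz rule followed by a multiplication by \<open>A\<close>, so the sum over trees with
  \<open>n + 1\<close> vertices is \<open>L\<^sup>n A\<close> with \<open>L f = A f'\<close>. For \<open>A = x(t)\<close> its constant term is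
  \<open>p\<^sub>n\<^sub>+\<^sub>1\<close>.

  Let \<open>Q' = 1/A\<close>, \<open>Q(0) = 0\<close>. Since \<open>L Q = 1\<close> and residues of derivatives vanish, \<open>L\<close> may be moved by
  partial integration onto powers of \<open>1/Q\<close>, and \<open>(L\<^sup>m f)(0) = m! Res (f Q' / Q\<^sup>m\<^sup>+\<^sup>1)\<close>.
  For \<open>f = A\<close> this is Lagrange inversion, without any composition of series. The \<open>b\<^sub>s/s!\<close>
  are the coefficients of \<open>1/A\<close>, and expanding \<open>Q\<^sup>-\<^sup>n\<close> around the linear term \<open>t/x\<^sub>0\<close> of \<open>Q\<close>
  by the binomial series gives the Bell polynomials.
\<close>

section \<open>Increasing trees\<close>

text \<open>The root of an increasing tree is forced to be 1, so the tree amounts to an independent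
  choice of a smaller parent for each of the vertices 2 to \<open>n\<close>. This replaces the
  global condition on walks by a local one on edges.\<close>

definition increasing_edges :: "nat \<Rightarrow> (nat \<times> nat) set set" where
  "increasing_edges n = {E. E \<subseteq> {(u, v). 1 \<le> u \<and> u < v \<and> v \<le> n} \<and>
     (\<forall>v\<in>{2..n}. \<exists>!u. (u, v) \<in> E)}"

lemma increasing_edgesI:
  assumes "\<And>u v. (u, v) \<in> E \<Longrightarrow> 1 \<le> u \<and> u < v \<and> v \<le> n"
    and "\<And>v. v \<in> {2..n} \<Longrightarrow> \<exists>!u. (u, v) \<in> E"
  shows "E \<in> increasing_edges n"
  using assms unfolding increasing_edges_def by blast

lemma increasing_edges_less:
  assumes "E \<in> increasing_edges n" "(u, v) \<in> E"
  shows "1 \<le> u \<and> u < v \<and> v \<le> n"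
  using assms unfolding increasing_edges_def by blast

lemma increasing_edges_parent:
  assumes "E \<in> increasing_edges n" "v \<in> {2..n}"
  shows "\<exists>!u. (u, v) \<in> E"
  using assms unfolding increasing_edges_def by blast

section \<open>Increasing trees as choices of parents\<close>

lemma walk_snoc: "p \<noteq> [] \<Longrightarrow> walk E (p @ [v]) \<longleftrightarrow> walk E p \<and> (last p, v) \<in> E"
  by (auto simp: walk_def successively_append_iff)

lemma walk_append1: "walk E (p @ q) \<Longrightarrow> p \<noteq> [] \<Longrightarrow> walk E p"
  by (auto simp: walk_def successively_append_iff)

lemma walk_sorted:
  fixes E :: "(nat \<times> nat) set"
  assumes "walk E p" and "\<And>u v. (u, v) \<in> E \<Longrightarrow> u < v"
  shows "sorted_wrt (<) p"
proof -
  have "successively (<) p"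
    using assms by (auto simp: walk_def intro: successively_mono)
  then show ?thesis by (simp add: successively_conv_sorted_wrt)
qed

text \<open>If the last vertex had been visited before, the prefix ending at that visit would be a
  second walk from the root to it. Together with finiteness of \<open>V\<close> this bounds the
  length of walks from the root.\<close>

lemma rooted_tree_walk_distinct:
  assumes "rooted_tree V r E" "walk E p" "hd p = r"
  shows "set p \<subseteq> V \<and> distinct p"
  using assms(2,3)
proof (induction p rule: rev_induct)
  case (snoc v p)
  show ?case
  proof (cases "p = []")
    case True
    then show ?thesis using snoc assms(1) by (simp add: rooted_tree_def)
  next
    case False
    have p: "walk E p" "hd p = r" "(last p, v) \<in> E"
      using snoc.prems False by (simp_all add: walk_snoc)
    have v: "v \<in> V" using p assms(1) by (auto simp: rooted_tree_def)
    have "v \<notin> set p"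
    proof
      assume "v \<in> set p"
      then obtain xs ys where xs: "p = xs @ v # ys" by (meson split_list)
      have "walk E (xs @ [v])" using p(1) xs walk_append1[of E "xs @ [v]" ys] by simp
      moreover have "hd (xs @ [v]) = r" using p(2) xs by (cases xs) auto
      moreover have "\<exists>!q. walk E q \<and> hd q = r \<and> last q = v"
        using assms(1) v by (simp add: rooted_tree_def)
      ultimately have "xs @ [v] = p @ [v]"
        using snoc.prems by (metis last_snoc)
      then show False using xs by simp
    qed
    then show ?thesis using snoc.IH[OF p(1,2)] v by simp
  qed
qed (simp add: walk_def)

text \<open>Appending children must stop, since no walk from the root is longer than
  \<open>card V\<close>. The definition of increasing trees constrains only walks that end in a
  leaf; this lemma gives access to all walks from the root.\<close>

lemma rooted_tree_walk_extends_to_leaf: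
  assumes "finite V" "rooted_tree V r E" "walk E p" "hd p = r"
  shows "\<exists>q. walk E (p @ q) \<and> children E (last (p @ q)) = {}"
  using assms(3,4)
proof (induction "card V - length p" arbitrary: p rule: less_induct)
  case less
  have ne: "p \<noteq> []" using less.prems(1) by (simp add: walk_def)
  show ?case
  proof (cases "children E (last p) = {}")
    case True
    then show ?thesis using less.prems by (intro exI[of _ "[]"]) simp
  next
    case False
    then obtain v where v: "(last p, v) \<in> E" by (auto simp: children_def)
    have w: "walk E (p @ [v])" "hd (p @ [v]) = r"
      using less.prems v ne by (auto simp: walk_snoc)
    have "length (p @ [v]) \<le> card V"
      using rooted_tree_walk_distinct[OF assms(2) w] assms(1)
      by (metis card_mono distinct_card)
    then have "card V - length (p @ [v]) < card V - length p" by simp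
    from less.hyps[OF this w] obtain q where
      "walk E ((p @ [v]) @ q)" "children E (last ((p @ [v]) @ q)) = {}" by blast
    then show ?thesis by (intro exI[of _ "v # q"]) simp
  qed
qed

lemma increasing_tree_imp_increasing_edges:
  assumes "increasing_tree n r E"
  shows "1 \<le> n \<and> r = 1 \<and> E \<in> increasing_edges n"
proof -
  have tree: "rooted_tree {1..n} r E"
    and leaf: "\<And>p. walk E p \<Longrightarrow> hd p = r \<Longrightarrow> children E (last p) = {} \<Longrightarrow> sorted_wrt (<) p"
    using assms by (auto simp: increasing_tree_def)
  have r: "r \<in> {1..n}" and EV: "\<And>u v. (u, v) \<in> E \<Longrightarrow> u \<in> {1..n} \<and> v \<in> {1..n}"
    and uniq: "\<And>v. v \<in> {1..n} \<Longrightarrow> \<exists>!p. walk E p \<and> hd p = r \<and> last p = v"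
    using tree by (auto simp: rooted_tree_def)
  \<comment> \<open>A walk from the root is a prefix of one that ends in a leaf, and prefixes of
    sorted lists are sorted.\<close>
  have sorted: "sorted_wrt (<) p" if p: "walk E p" "hd p = r" for p
  proof -
    obtain q where "walk E (p @ q)" "children E (last (p @ q)) = {}"
      using rooted_tree_walk_extends_to_leaf[OF _ tree p] by auto
    moreover have "hd (p @ q) = r" using p by (simp add: walk_def)
    ultimately show ?thesis using leaf[of "p @ q"] by (simp add: sorted_wrt_append)
  qed
  have less: "u < v" if uv: "(u, v) \<in> E" for u v
  proof -
    obtain p where p: "walk E p" "hd p = r" "last p = u" using uniq[of u] EV[OF uv] by blast
    then have ne: "p \<noteq> []" by (simp add: walk_def)
    then have "sorted_wrt (<) (p @ [v])" using p uv by (intro sorted) (auto simp: walk_snoc)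
    then show ?thesis using p(3) ne by (auto simp: sorted_wrt_append)
  qed
  have root_le: "r \<le> v" if v: "v \<in> {1..n}" for v
  proof -
    obtain p where p: "walk E p" "hd p = r" "last p = v" using uniq[OF v] by blast
    then have "sorted_wrt (<) p" "p \<noteq> []" using sorted by (auto simp: walk_def)
    then have "\<forall>w\<in>set p. hd p \<le> w" by (cases p) auto
    then show ?thesis using p \<open>p \<noteq> []\<close> by auto
  qed
  have r1: "r = 1" using r root_le[of 1] by auto
  have "\<exists>!u. (u, v) \<in> E" if v: "v \<in> {2..n}" for v
  proof -
    obtain p where p: "walk E p" "hd p = r" "last p = v" using uniq[of v] v by auto
    obtain q where q: "p = q @ [v]" using p by (metis append_butlast_last_id walk_def)
    then have "q \<noteq> []" using p(2) r1 v by auto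
    then have "(last q, v) \<in> E" using p(1) q by (simp add: walk_snoc)
    \<comment> \<open>Two distinct parents of \<open>v\<close> would give two distinct walks from
      the root to \<open>v\<close>.\<close>
    moreover have "u = u'" if uu: "(u, v) \<in> E" "(u', v) \<in> E" for u u'
    proof -
      obtain p where p: "walk E p" "hd p = r" "last p = u"
        using uniq[of u] EV[OF uu(1)] by blast
      obtain p' where p': "walk E p'" "hd p' = r" "last p' = u'"
        using uniq[of u'] EV[OF uu(2)] by blast
      have ne: "p \<noteq> []" "p' \<noteq> []" using p(1) p'(1) by (auto simp: walk_def)
      have "walk E (p @ [v])" "walk E (p' @ [v])" "hd (p @ [v]) = r" "hd (p' @ [v]) = r"
        using p p' ne uu by (simp_all add: walk_snoc)
      then have "p @ [v] = p' @ [v]" using uniq[of v] EV[OF uu(1)] by (metis last_snoc)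
      then show ?thesis using p p' by simp
    qed
    ultimately show ?thesis by blast
  qed
  moreover have "1 \<le> u \<and> u < v \<and> v \<le> n" if "(u, v) \<in> E" for u v
    using EV[OF that] less[OF that] by simp
  ultimately have "E \<in> increasing_edges n" by (intro increasing_edgesI)
  then show ?thesis using r r1 by simp
qed

text \<open>Strong induction on \<open>v\<close> gives the unique walk: its last edge must come from
  the only parent of \<open>v\<close>, which is smaller. For \<open>v = 1\<close> sortedness
  excludes any return to 1.\<close>

lemma increasing_edges_imp_increasing_tree:
  assumes "1 \<le> n" "E \<in> increasing_edges n"
  shows "increasing_tree n 1 E"
proof -
  have E: "1 \<le> u \<and> u < v \<and> v \<le> n" if "(u, v) \<in> E" for u v
    using assms(2) that by (rule increasing_edges_less)
  have parent: "\<exists>!u. (u, v) \<in> E" if "v \<in> {2..n}" for v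
    using assms(2) that by (rule increasing_edges_parent)
  have sorted: "sorted_wrt (<) p" if "walk E p" for p
    using walk_sorted[OF that] E by blast
  have "\<exists>!p. walk E p \<and> hd p = 1 \<and> last p = v" if "v \<in> {1..n}" for v
    using that
  proof (induction v rule: less_induct)
    case (less v)
    show ?case
    proof (cases "v = 1")
      case True
      show ?thesis
      proof (rule ex1I[of _ "[1]"])
        show "walk E [1] \<and> hd [1] = 1 \<and> last [1] = v" using True by (simp add: walk_def)
      next
        fix p assume p: "walk E p \<and> hd p = 1 \<and> last p = v"
        then have "sorted_wrt (<) p" "p \<noteq> []" using sorted by (auto simp: walk_def)
        moreover have "\<not> 1 < last (tl p)" if "tl p \<noteq> []" using p True that by (cases p) auto
        ultimately show "p = [1]" using p by (cases p) auto
      qed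
    next
      case False
      then obtain u where u: "(u, v) \<in> E" "\<And>u'. (u', v) \<in> E \<Longrightarrow> u' = u"
        using parent[of v] less.prems by (metis One_nat_def Suc_leI atLeastAtMost_iff le_neq_implies_less numeral_2_eq_2)
      have "u \<in> {1..n}" "u < v" using E[OF u(1)] by auto
      from less.IH[OF this(2,1)] obtain q where q: "walk E q" "hd q = 1" "last q = u"
        "\<And>q'. walk E q' \<Longrightarrow> hd q' = 1 \<Longrightarrow> last q' = u \<Longrightarrow> q' = q"
        by blast
      have ne: "q \<noteq> []" using q(1) by (simp add: walk_def)
      show ?thesis
      proof (rule ex1I[of _ "q @ [v]"])
        show "walk E (q @ [v]) \<and> hd (q @ [v]) = 1 \<and> last (q @ [v]) = v"
          using q(1-3) u(1) ne by (simp add: walk_snoc)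
      next
        fix p assume p: "walk E p \<and> hd p = 1 \<and> last p = v"
        obtain p' where p': "p = p' @ [v]" using p by (metis append_butlast_last_id walk_def)
        have ne': "p' \<noteq> []" using p p' False by auto
        have "walk E p'" "(last p', v) \<in> E" "hd p' = 1" using p p' ne' by (auto simp: walk_snoc)
        then have "p' = q" using q(4) u(2) by blast
        then show "p = q @ [v]" using p' by simp
      qed
    qed
  qed
  moreover have "E \<subseteq> {1..n} \<times> {1..n}" using E by fastforce
  ultimately show ?thesis
    using assms(1) sorted unfolding increasing_tree_def rooted_tree_def by simp
qed

lemma increasing_tree_iff:
  "increasing_tree n r E \<longleftrightarrow> 1 \<le> n \<and> r = 1 \<and> E \<in> increasing_edges n"
  using increasing_tree_imp_increasing_edges increasing_edges_imp_increasing_tree by blast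

lemma tree_sum_conv_increasing_edges:
  assumes "1 \<le> n"
  shows "tree_sum x n = (\<Sum>E\<in>increasing_edges n. \<Prod>v\<in>{1..n}. x (card (children E v)))"
proof -
  have "{(r, E). increasing_tree n r E} = Pair 1 ` increasing_edges n"
    using assms by (auto simp: increasing_tree_iff)
  then show ?thesis by (simp add: tree_sum_def sum.reindex inj_on_def)
qed

lemma tree_sum_1: "tree_sum x 1 = x 0"
proof -
  have "increasing_edges 1 = {{}}" by (auto simp: increasing_edges_def)
  then show ?thesis
    by (simp only: tree_sum_conv_increasing_edges[OF order_refl]) (simp add: children_def)
qed

section \<open>Recursion by the largest label\<close>

text \<open>The inverse deletes the only edge into \<open>Suc n\<close>. No edge leaves
  \<open>Suc n\<close>, because its target would have a larger label, so what remains lives on 1 to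
  \<open>n\<close>.\<close>

lemma bij_betw_attach_leaf:
  assumes "1 \<le> n"
  shows "bij_betw (\<lambda>(E, v). insert (v, Suc n) E) (increasing_edges n \<times> {1..n}) (increasing_edges (Suc n))"
proof (rule bij_betwI')
  fix a b assume a: "a \<in> increasing_edges n \<times> {1..n}" and b: "b \<in> increasing_edges n \<times> {1..n}"
  obtain E v E' v' where ab: "a = (E, v)" "b = (E', v')" by fastforce
  have nin: "(w, Suc n) \<notin> E" "(w, Suc n) \<notin> E'" for w
    using a b ab increasing_edges_less[of E n w "Suc n"] increasing_edges_less[of E' n w "Suc n"]
    by auto
  have "E = E' \<and> v = v'" if "insert (v, Suc n) E = insert (v', Suc n) E'"
  proof -
    have "(v, Suc n) \<in> insert (v', Suc n) E'" using that by blast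
    then have "v = v'" using nin by simp
    then show ?thesis using that nin by (simp add: insert_ident)
  qed
  then show "((case a of (E, v) \<Rightarrow> insert (v, Suc n) E) = (case b of (E, v) \<Rightarrow> insert (v, Suc n) E)) = (a = b)"
    unfolding ab by auto
next
  fix a assume a: "a \<in> increasing_edges n \<times> {1..n}"
  obtain E v where ab: "a = (E, v)" by fastforce
  have E: "E \<in> increasing_edges n" and v: "v \<in> {1..n}" using a ab by auto
  have "insert (v, Suc n) E \<in> increasing_edges (Suc n)"
  proof (rule increasing_edgesI)
    show "1 \<le> u \<and> u < w \<and> w \<le> Suc n" if "(u, w) \<in> insert (v, Suc n) E" for u w
      using that v increasing_edges_less[OF E, of u w] by auto
    show "\<exists>!u. (u, w) \<in> insert (v, Suc n) E" if "w \<in> {2..Suc n}" for w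
    proof (cases "w = Suc n")
      case True
      then show ?thesis using increasing_edges_less[OF E, of _ "Suc n"] by force
    next
      case False
      then show ?thesis using increasing_edges_parent[OF E, of w] that by simp
    qed
  qed
  then show "(case a of (E, v) \<Rightarrow> insert (v, Suc n) E) \<in> increasing_edges (Suc n)"
    by (simp add: ab)
next
  fix E assume E: "E \<in> increasing_edges (Suc n)"
  have "\<exists>!u. (u, Suc n) \<in> E" using increasing_edges_parent[OF E] assms by simp
  then obtain v where v: "(v, Suc n) \<in> E" "\<And>u. (u, Suc n) \<in> E \<Longrightarrow> u = v"
    by blast
  define F where "F = E - {(v, Suc n)}"
  have "F \<in> increasing_edges n"
  proof (rule increasing_edgesI)
    show "1 \<le> u \<and> u < w \<and> w \<le> n" if "(u, w) \<in> F" for u w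
      using that v(2)[of u] increasing_edges_less[OF E, of u w] by (auto simp: F_def le_Suc_eq)
    show "\<exists>!u. (u, w) \<in> F" if "w \<in> {2..n}" for w
      using increasing_edges_parent[OF E, of w] that by (simp add: F_def)
  qed
  moreover have "v \<in> {1..n}" using increasing_edges_less[OF E v(1)] by simp
  moreover have "E = insert (v, Suc n) F" using v(1) by (auto simp: F_def)
  ultimately show "\<exists>a\<in>increasing_edges n \<times> {1..n}. E = (case a of (E, v) \<Rightarrow> insert (v, Suc n) E)"
    by (intro bexI[of _ "(F, v)"]) auto
qed

text \<open>The new leaf contributes \<open>x 0\<close>, and only the degree of its parent
  \<open>v\<close> changes, going up by one. Raising one index at a time has the shape of the
  Leibniz rule.\<close>

lemma tree_sum_Suc:
  assumes "1 \<le> n"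
  shows "tree_sum x (Suc n) = x 0 * (\<Sum>E\<in>increasing_edges n. \<Sum>v\<in>{1..n}.
    x (Suc (card (children E v))) * (\<Prod>w\<in>{1..n} - {v}. x (card (children E w))))"
proof -
  have weight: "(\<Prod>w\<in>{1..Suc n}. x (card (children (insert (v, Suc n) E) w))) =
      x 0 * (x (Suc (card (children E v))) * (\<Prod>w\<in>{1..n} - {v}. x (card (children E w))))"
    if E: "E \<in> increasing_edges n" and v: "v \<in> {1..n}" for E v
  proof -
    let ?E = "insert (v, Suc n) E"
    note sub = increasing_edges_less[OF E]
    have ch: "children ?E w = (if w = v then insert (Suc n) (children E v) else children E w)" for w
      by (auto simp: children_def)
    have "children E (Suc n) = {}" using sub by (fastforce simp: children_def)
    then have 1: "card (children ?E (Suc n)) = 0" using v by (simp add: ch)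
    have "children E v \<subseteq> {1..n}" using sub by (force simp: children_def)
    then have "finite (children E v)" "Suc n \<notin> children E v" by (auto intro: finite_subset)
    then have 2: "card (children ?E v) = Suc (card (children E v))" by (simp add: ch)
    have "(\<Prod>w\<in>{1..Suc n}. x (card (children ?E w))) = x 0 * (\<Prod>w\<in>{1..n}. x (card (children ?E w)))"
      using 1 by (simp add: prod.nat_ivl_Suc' mult.commute)
    also have "(\<Prod>w\<in>{1..n}. x (card (children ?E w))) =
        x (card (children ?E v)) * (\<Prod>w\<in>{1..n} - {v}. x (card (children ?E w)))"
      using v by (intro prod.remove) auto
    also have "(\<Prod>w\<in>{1..n} - {v}. x (card (children ?E w))) = (\<Prod>w\<in>{1..n} - {v}. x (card (children E w)))"
      by (intro prod.cong) (auto simp: ch)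
    finally show ?thesis using 2 by simp
  qed
  have "tree_sum x (Suc n) = (\<Sum>(E, v)\<in>increasing_edges n \<times> {1..n}.
      \<Prod>w\<in>{1..Suc n}. x (card (children (insert (v, Suc n) E) w)))"
    by (simp only: tree_sum_conv_increasing_edges le_add1 plus_1_eq_Suc[symmetric])
       (simp add: sum.reindex_bij_betw[OF bij_betw_attach_leaf[OF assms], symmetric] case_prod_unfold)
  also have "\<dots> = (\<Sum>E\<in>increasing_edges n. \<Sum>v\<in>{1..n}. \<Prod>w\<in>{1..Suc n}. x (card (children (insert (v, Suc n) E) w)))"
    by (simp only: sum.cartesian_product)
  also have "\<dots> = (\<Sum>E\<in>increasing_edges n. \<Sum>v\<in>{1..n}.
      x 0 * (x (Suc (card (children E v))) * (\<Prod>w\<in>{1..n} - {v}. x (card (children E w)))))"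
    by (intro sum.cong refl weight)
  finally show ?thesis by (simp only: sum_distrib_left)
qed

section \<open>Tree sums at the derivatives of a power series\<close>

lemma fps_deriv_prod:
  fixes f :: "'i \<Rightarrow> 'a::comm_semiring_1 fps"
  assumes "finite S"
  shows "fps_deriv (\<Prod>i\<in>S. f i) = (\<Sum>j\<in>S. fps_deriv (f j) * (\<Prod>i\<in>S - {j}. f i))"
  using assms
proof (induction S rule: finite_induct)
  case (insert a S)
  have "(\<Prod>i\<in>insert a S - {j}. f i) = f a * (\<Prod>i\<in>S - {j}. f i)" if "j \<in> S" for j
  proof -
    have "insert a S - {j} = insert a (S - {j})" using insert.hyps that by auto
    then show ?thesis using insert.hyps by simp
  qed
  then have "(\<Sum>j\<in>S. fps_deriv (f j) * (\<Prod>i\<in>insert a S - {j}. f i)) = f a * fps_deriv (\<Prod>i\<in>S. f i)"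
    by (simp add: insert.IH sum_distrib_left mult_ac)
  moreover have "insert a S - {a} = S" using insert.hyps by auto
  ultimately show ?case using insert.hyps by (simp add: mult.commute add.commute)
qed simp

lemma fps_prod_nth_0: "(\<Prod>i\<in>S. f i) $ 0 = (\<Prod>i\<in>S. f i $ 0 :: 'a::comm_semiring_1)"
  by (induction S rule: infinite_finite_induct) auto

text \<open>At iterated derivatives, raising an index by one is differentiation, so the double sum
  in \<open>tree_sum_Suc\<close> is the derivative of the previous tree sum; the factor
  \<open>x 0\<close> becomes \<open>A\<close>.\<close>

lemma tree_sum_derivatives_Suc:
  fixes A :: "'a::comm_ring_1 fps"
  assumes "1 \<le> n"
  shows "tree_sum (\<lambda>i. fps_nth_deriv i A) (Suc n) = A * fps_deriv (tree_sum (\<lambda>i. fps_nth_deriv i A) n)"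
  unfolding tree_sum_Suc[OF assms] unfolding tree_sum_conv_increasing_edges[OF assms]
  by (simp add: fps_deriv_sum fps_deriv_prod fps_nth_deriv_commute del: fps_nth_deriv.simps(2))

lemma tree_sum_derivatives:
  fixes A :: "'a::comm_ring_1 fps"
  shows "tree_sum (\<lambda>i. fps_nth_deriv i A) (Suc n) = ((\<lambda>f. A * fps_deriv f) ^^ n) A"
proof (induction n)
  case 0
  then show ?case using tree_sum_1[of "\<lambda>i. fps_nth_deriv i A"] by simp
next
  case (Suc n)
  then show ?case by (simp add: tree_sum_derivatives_Suc)
qed

text \<open>Taking the constant term is a ring homomorphism; this leads back from series to
  numbers.\<close>

lemma tree_sum_fps_nth_0:
  assumes "1 \<le> n"
  shows "tree_sum f n $ 0 = tree_sum (\<lambda>i. f i $ 0) n"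
  by (simp add: tree_sum_conv_increasing_edges[OF assms] fps_sum_nth fps_prod_nth_0)

section \<open>Bell polynomials as coefficients of powers\<close>

lemma finite_multi_indices:
  assumes "finite S"
  shows "finite {\<alpha>. (\<forall>i. i \<notin> S \<longrightarrow> \<alpha> i = (0::nat)) \<and> (\<Sum>i\<in>S. \<alpha> i) = k}"
proof (rule finite_subset)
  show "{\<alpha>. (\<forall>i. i \<notin> S \<longrightarrow> \<alpha> i = 0) \<and> (\<Sum>i\<in>S. \<alpha> i) = k} \<subseteq>
      {f. \<forall>i. (i \<in> S \<longrightarrow> f i \<in> {..k}) \<and> (i \<notin> S \<longrightarrow> f i = 0)}"
    using assms by (auto intro: member_le_sum)
  show "finite {f. \<forall>i. (i \<in> S \<longrightarrow> f i \<in> {..k}) \<and> (i \<notin> S \<longrightarrow> f i = (0::nat))}"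
    using assms by (intro finite_set_of_finite_funs) auto
qed

text \<open>Induction on \<open>S\<close>: the binomial theorem splits off the exponent
  \<open>m\<close> of the new index \<open>j\<close>, and the binomial coefficient times the
  multinomial coefficient for \<open>S\<close> is the one for \<open>insert j S\<close>.
  Multi-indices vanish outside \<open>S\<close>, as in \<open>bell_index\<close>.\<close>

lemma fps_multinomial:
  fixes z :: "'i \<Rightarrow> 'a::field_char_0 fps"
  assumes "finite S"
  shows "(\<Sum>i\<in>S. z i) ^ k =
    (\<Sum>\<alpha> | (\<forall>i. i \<notin> S \<longrightarrow> \<alpha> i = 0) \<and> (\<Sum>i\<in>S. \<alpha> i) = k.
       fps_const (fact k / (\<Prod>i\<in>S. fact (\<alpha> i))) * (\<Prod>i\<in>S. z i ^ \<alpha> i))"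
  using assms
proof (induction S arbitrary: k rule: finite_induct)
  case empty
  have "{\<alpha>. (\<forall>i. \<alpha> i = 0) \<and> 0 = k} = (if k = 0 then {\<lambda>i::'i. 0::nat} else {})"
    by auto
  then show ?case by (simp add: power_0_left)
next
  case (insert j S)
  define M where "M T k = {\<alpha>. (\<forall>i. i \<notin> T \<longrightarrow> \<alpha> i = 0) \<and> (\<Sum>i\<in>T. \<alpha> i) = k}"
    for T :: "'i set" and k :: nat
  define c where "c T \<alpha> k = fps_const (fact k / (\<Prod>i\<in>T. fact (\<alpha> i))) * (\<Prod>i\<in>T. z i ^ \<alpha> i)"
    for T \<alpha> k
  have fin: "finite (M S m)" for m
    unfolding M_def by (rule finite_multi_indices[OF insert.hyps(1)])
  have step: "of_nat (k choose m) * z j ^ m * c S \<alpha> (k - m) = c (insert j S) (\<alpha>(j := m)) k"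
    if "m \<le> k" for m \<alpha>
  proof -
    have "(\<Prod>i\<in>S. z i ^ (if i = j then m else \<alpha> i)) = (\<Prod>i\<in>S. z i ^ \<alpha> i)"
      "(\<Prod>i\<in>S. fact (if i = j then m else \<alpha> i)) = (\<Prod>i\<in>S. fact (\<alpha> i) :: 'a)"
      using insert.hyps by (auto intro!: prod.cong)
    moreover have "of_nat (k choose m) * (fact (k - m) / P) = fact k / (fact m * P)" for P :: 'a
      using that by (simp add: binomial_fact)
    ultimately show ?thesis
      using insert.hyps
      by (simp add: c_def fun_upd_def mult_ac flip: fps_of_nat fps_const_mult)
  qed
  have "(\<Sum>i\<in>insert j S. z i) ^ k = (\<Sum>m\<le>k. of_nat (k choose m) * z j ^ m * (\<Sum>i\<in>S. z i) ^ (k - m))"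
    using insert.hyps by (simp add: binomial_ring)
  also have "\<dots> = (\<Sum>m\<le>k. \<Sum>\<alpha>\<in>M S (k - m). of_nat (k choose m) * z j ^ m * c S \<alpha> (k - m))"
    by (simp add: insert.IH M_def c_def sum_distrib_left)
  also have "\<dots> = (\<Sum>m\<le>k. \<Sum>\<alpha>\<in>M S (k - m). c (insert j S) (\<alpha>(j := m)) k)"
    by (intro sum.cong refl step) auto
  also have "\<dots> = (\<Sum>(m, \<alpha>)\<in>Sigma {..k} (\<lambda>m. M S (k - m)). c (insert j S) (\<alpha>(j := m)) k)"
    using fin by (simp add: sum.Sigma)
  also have "\<dots> = (\<Sum>\<alpha>\<in>M (insert j S) k. c (insert j S) \<alpha> k)"
  \<comment> \<open>A multi-index on \<open>insert j S\<close> corresponds to its value at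
    \<open>j\<close> paired with the same function reset to 0 at \<open>j\<close>.\<close>
  proof (rule sum.reindex_bij_witness[where j = "\<lambda>(m, \<alpha>). \<alpha>(j := m)"
        and i = "\<lambda>\<alpha>. (\<alpha> j, \<alpha>(j := 0))"])
    have eq: "(\<Sum>i\<in>S. (\<alpha>(j := m)) i) = (\<Sum>i\<in>S. \<alpha> i)" for \<alpha> :: "'i \<Rightarrow> nat" and m
      using insert.hyps by (intro sum.cong) auto
    show "(case a of (m, \<alpha>) \<Rightarrow> \<alpha>(j := m)) \<in> M (insert j S) k"
      if "a \<in> Sigma {..k} (\<lambda>m. M S (k - m))" for a
      using that insert.hyps eq[unfolded fun_upd_apply] by (auto simp: M_def)
    show "(\<alpha> j, \<alpha>(j := 0)) \<in> Sigma {..k} (\<lambda>m. M S (k - m))" if "\<alpha> \<in> M (insert j S) k" for \<alpha>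
      using that insert.hyps eq[of \<alpha> 0] by (auto simp: M_def)
    show "(\<lambda>\<alpha>. (\<alpha> j, \<alpha>(j := 0))) (case a of (m, \<alpha>) \<Rightarrow> \<alpha>(j := m)) = a"
      if "a \<in> Sigma {..k} (\<lambda>m. M S (k - m))" for a
      using that insert.hyps by (auto simp: M_def)
  qed (auto simp: M_def)
  finally show ?case by (simp only: M_def c_def)
qed

lemma fps_const_prod: "fps_const (\<Prod>i\<in>S. f i) = (\<Prod>i\<in>S. fps_const (f i :: 'a::comm_semiring_1))"
  by (induction S rule: infinite_finite_induct) (auto simp flip: fps_const_mult)

lemma fps_power_nth_cong:
  fixes f g :: "'a::comm_semiring_1 fps"
  assumes "\<And>i. i \<le> m \<Longrightarrow> f $ i = g $ i" and "i \<le> m"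
  shows "(f ^ k) $ i = (g ^ k) $ i"
  using assms(2)
proof (induction k arbitrary: i)
  case (Suc k)
  then show ?case using assms(1) by (auto simp: fps_mult_nth intro!: sum.cong)
qed simp

text \<open>The exponential generating function of \<open>y\<close> from index 1 on; the value
  \<open>y 0\<close> is dropped.\<close>

definition egf1 :: "(nat \<Rightarrow> 'a::field_char_0) \<Rightarrow> 'a fps" where
  "egf1 y = Abs_fps (\<lambda>i. if i = 0 then 0 else y i / fact i)"

text \<open>Expand the power by the multinomial theorem; the coefficient at \<open>n\<close> selects
  the multi-indices of weight \<open>n\<close>. All \<open>k\<close> factors have order at least 1,
  so none contributes a degree above \<open>n+1-k\<close>, which allows \<open>egf1 y\<close> to be
  replaced by a polynomial.\<close>

lemma bell_conv_egf1_power: "bell n k y = fact n / fact k * (egf1 y ^ k) $ n"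
proof (cases "k \<le> n")
  case False
  then have "bell_index n k = {}" by (auto simp: bell_index_def)
  moreover have "(egf1 y ^ k) $ n = 0"
    using False startsby_zero_power_prefix[of "egf1 y" k] by (simp add: egf1_def)
  ultimately show ?thesis by (simp add: bell_def)
next
  case True
  let ?S = "{1..n+1-k}"
  let ?a = "\<lambda>i. y i / fact i"
  define g where "g = (\<Sum>i\<in>?S. fps_const (?a i) * fps_X ^ i)"
  have g_nth: "g $ i = (if i \<in> ?S then ?a i else 0)" for i
    by (simp add: g_def fps_sum_nth if_distrib cong: if_cong)
  \<comment> \<open>Taking one \<open>fps_X\<close> out of each factor lowers the target degree to
    \<open>n - k\<close>. There only the first \<open>n+1-k\<close> coefficients after the constant
    term matter, and on these \<open>egf1 y\<close> and \<open>g\<close> agree.\<close>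
  have shift: "(f ^ k) $ n = (fps_shift 1 f ^ k) $ (n - k)" if "f $ 0 = 0" for f :: "'a fps"
  proof -
    have "f = fps_X * fps_shift 1 f"
      using that by (simp add: fps_eq_iff)
    then have "f ^ k = fps_X ^ k * fps_shift 1 f ^ k" by (metis power_mult_distrib)
    then show ?thesis using True by (simp add: fps_X_power_mult_nth)
  qed
  have "(egf1 y ^ k) $ n = (fps_shift 1 (egf1 y) ^ k) $ (n - k)"
    by (rule shift) (simp add: egf1_def)
  also have "\<dots> = (fps_shift 1 g ^ k) $ (n - k)"
    using True by (intro fps_power_nth_cong[of "n - k"]) (auto simp: egf1_def g_nth)
  also have "\<dots> = (g ^ k) $ n"
    by (rule shift[symmetric]) (simp add: g_nth)
  also have "\<dots> = (\<Sum>\<alpha> | (\<forall>i. i \<notin> ?S \<longrightarrow> \<alpha> i = 0) \<and> (\<Sum>i\<in>?S. \<alpha> i) = k.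
      if (\<Sum>i\<in>?S. i * \<alpha> i) = n then fact k / (\<Prod>i\<in>?S. fact (\<alpha> i)) * (\<Prod>i\<in>?S. ?a i ^ \<alpha> i) else 0)"
  proof -
    have "(\<Prod>i\<in>?S. (fps_const (?a i) * fps_X ^ i) ^ \<alpha> i)
        = fps_const (\<Prod>i\<in>?S. ?a i ^ \<alpha> i) * fps_X ^ (\<Sum>i\<in>?S. i * \<alpha> i)" for \<alpha>
      by (simp add: power_mult_distrib prod.distrib power_mult[symmetric] power_sum fps_const_prod)
    then show ?thesis
      unfolding g_def fps_multinomial[OF finite_atLeastAtMost]
      by (auto simp: fps_sum_nth intro!: sum.cong)
  qed
  also have "\<dots> = (\<Sum>\<alpha>\<in>bell_index n k. fact k / (\<Prod>i\<in>?S. fact (\<alpha> i)) * (\<Prod>i\<in>?S. ?a i ^ \<alpha> i))"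
  proof -
    have fin: "finite {\<alpha>. (\<forall>i. i \<notin> ?S \<longrightarrow> \<alpha> i = 0) \<and> (\<Sum>i\<in>?S. \<alpha> i) = k}"
      by (rule finite_multi_indices) simp
    show ?thesis
      by (subst sum.inter_filter[OF fin, symmetric]) (rule sum.cong; force simp: bell_index_def)
  qed
  finally show ?thesis
    by (simp add: bell_def sum_distrib_left mult.assoc)
qed

section \<open>Lagrange inversion by residues\<close>

text \<open>Since \<open>inverse H\<close> is a power series, the pole comes only from
  \<open>fps_X\<close> to the power \<open>-(m+1)\<close>, which moves coefficient \<open>m\<close>
  to position -1.\<close>

lemma fls_residue_times_inverse_power:
  fixes g H :: "'a::field fps"
  assumes "H $ 0 \<noteq> 0"
  shows "fls_residue (fps_to_fls g * inverse (fps_to_fls (fps_X * H)) ^ Suc m) =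
    (g * inverse H ^ Suc m) $ m"
proof -
  have "inverse (fps_to_fls (fps_X * H)) = fls_X_inv * fps_to_fls (inverse H)"
    using assms by (simp add: fls_times_fps_to_fls fls_inverse_fps_to_fls subdegree_eq_0 fls_inverse_X)
  then have "fps_to_fls g * inverse (fps_to_fls (fps_X * H)) ^ Suc m =
      fls_X_inv ^ Suc m * fps_to_fls (g * inverse H ^ Suc m)"
    by (simp only: fls_times_fps_to_fls fps_to_fls_power power_mult_distrib mult_ac)
  then show ?thesis
    by (simp add: fls_X_inv_power_times_conv_shift del: power_Suc)
qed

text \<open>Induction on \<open>m\<close> for all \<open>f\<close>, with the hypothesis used at
  \<open>A * fps_deriv f\<close>, where \<open>A\<close> cancels against the derivative of
  \<open>Q\<close>. Partial integration then raises the pole order by one and yields the factor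
  \<open>m + 1\<close>. In the base case \<open>Q\<close> has a simple zero, so the residue is
  \<open>f $ 0\<close>.\<close>

lemma fps_nth_0_iterate_deriv:
  fixes A Q :: "'a::field_char_0 fps"
  assumes "A * fps_deriv Q = 1" and "Q $ 0 = 0"
  shows "((\<lambda>f. A * fps_deriv f) ^^ m) f $ 0 =
    fact m * fls_residue (fps_to_fls (f * fps_deriv Q) * inverse (fps_to_fls Q) ^ Suc m)"
proof -
  define H where "H = fps_shift 1 Q"
  have Q: "Q = fps_X * H" using assms(2) by (simp add: H_def fps_eq_iff)
  have "A $ 0 * Q $ 1 = 1" using arg_cong[OF assms(1), of "\<lambda>g. g $ 0"] by simp
  then have H0: "H $ 0 \<noteq> 0" and dQ: "fps_deriv Q $ 0 = H $ 0" by (auto simp: H_def)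
  show ?thesis
  proof (induction m arbitrary: f)
    case 0
    have "fls_residue (fps_to_fls (f * fps_deriv Q) * inverse (fps_to_fls Q) ^ Suc 0) =
        (f * fps_deriv Q * inverse H ^ Suc 0) $ 0"
      unfolding Q using H0 by (rule fls_residue_times_inverse_power)
    then show ?case using H0 dQ by simp
  next
    case (Suc m)
    let ?q = "fps_to_fls Q"
    have deriv: "fls_deriv (inverse ?q ^ Suc m) =
        - of_nat (Suc m) * fls_deriv ?q * inverse ?q ^ Suc (Suc m)"
      unfolding fls_deriv_power fls_inverse_deriv
      by (simp add: power2_eq_square mult_ac del: of_nat_Suc)
    have "((\<lambda>f. A * fps_deriv f) ^^ Suc m) f $ 0 =
        fact m * fls_residue (fps_to_fls (A * fps_deriv f * fps_deriv Q) * inverse ?q ^ Suc m)"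
      by (simp only: funpow_Suc_right o_apply Suc.IH)
    also have "A * fps_deriv f * fps_deriv Q = fps_deriv f"
      using assms(1) by (simp add: mult_ac)
    also have "fls_residue (fps_to_fls (fps_deriv f) * inverse ?q ^ Suc m) =
        - fls_residue (fps_to_fls f * fls_deriv (inverse ?q ^ Suc m))"
      by (simp only: fls_deriv_fps_to_fls[symmetric] fls_residue_times_deriv)
    also have "fps_to_fls f * fls_deriv (inverse ?q ^ Suc m) =
        of_int (- int (Suc m)) * (fps_to_fls (f * fps_deriv Q) * inverse ?q ^ Suc (Suc m))"
      unfolding deriv by (simp add: fls_deriv_fps_to_fls fls_times_fps_to_fls algebra_simps)
    finally show ?case
      by (simp only: fls_residue_of_int_times) (simp add: algebra_simps)
  qed
qed

section \<open>The negative binomial series and the reciprocal of x(t)\<close>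

text \<open>Substitute \<open>w\<close> into the binomial series of \<open>(1 - X)\<close> to the
  power \<open>-n\<close>. The sum stops at \<open>m\<close> because \<open>w ^ k\<close> has order
  at least \<open>k\<close>.\<close>

lemma fps_inverse_one_minus_power_nth:
  fixes w :: "'a::field_char_0 fps"
  assumes "w $ 0 = 0" "n > 0"
  shows "(inverse (1 - w) ^ n) $ m = (\<Sum>k=0..m. of_nat ((n + k - 1) choose k) * (w ^ k) $ m)"
proof -
  have "inverse (1 - w) ^ n = inverse ((1 - fps_const 1 * fps_X) ^ n) oo w"
    using assms(1)
    by (simp add: fps_inverse_compose fps_compose_sub_distrib fps_inverse_power
        flip: fps_compose_power)
  also have "\<dots> = Abs_fps (\<lambda>k. of_nat ((n + k - 1) choose k)) oo w"
    using assms(2) by (subst one_minus_const_fps_X_neg_power') auto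
  finally show ?thesis by (simp add: fps_compose_nth)
qed

text \<open>Write the series as \<open>x 0 * (1 - w)\<close> with \<open>w\<close> free of constant
  term and expand the reciprocal geometrically; the coefficients of \<open>w ^ k\<close> are Bell
  polynomials up to scaling.\<close>

lemma b_coeff_conv_fps_inverse:
  fixes x :: "nat \<Rightarrow> 'a::field_char_0"
  assumes "x 0 \<noteq> 0"
  shows "b_coeff x s = fact s * inverse (Abs_fps (\<lambda>n. x n / fact n)) $ s"
proof -
  define w where "w = fps_const (- 1 / x 0) * egf1 x"
  have "Abs_fps (\<lambda>n. x n / fact n) = fps_const (x 0) * (1 - w)"
    using assms by (auto simp: fps_eq_iff w_def egf1_def)
  then have "inverse (Abs_fps (\<lambda>n. x n / fact n)) = fps_const (1 / x 0) * inverse (1 - w)"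
    by (simp add: fps_inverse_mult fps_const_inverse divide_inverse)
  moreover have "inverse (1 - w) $ s = (\<Sum>k=0..s. (w ^ k) $ s)"
    using fps_inverse_one_minus_power_nth[of w 1 s] by (simp add: w_def egf1_def)
  moreover have "(w ^ k) $ s = (- 1 / x 0) ^ k * (egf1 x ^ k) $ s" for k
    by (simp add: w_def power_mult_distrib fps_const_power)
  moreover have "fact k / (- x 0) ^ k * bell s k x = fact s * ((- 1 / x 0) ^ k * (egf1 x ^ k) $ s)" for k
  proof -
    have "(- 1 / x 0) ^ k = 1 / (- x 0) ^ k" by (simp flip: power_one_over)
    then show ?thesis by (simp add: bell_conv_egf1_power)
  qed
  ultimately show ?thesis
    by (simp add: b_coeff_def sum_distrib_left mult_ac)
qed

theorem theorem3:
  fixes x :: "nat \<Rightarrow> 'a::field_char_0" and n :: nat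
  assumes "x 0 \<noteq> 0" and "n \<ge> 1"
  shows "tree_sum x n =
    x 0 ^ n * (\<Sum>k\<in>{0..n}. (- x 0) ^ k *
      bell (n + k - 1) k (\<lambda>i. if i = 1 then 0 else b_coeff x (i - 1)))"
proof -
  obtain m where n: "n = Suc m" using assms(2) by (cases n) auto
  \<comment> \<open>With the entry at 1 set to 0, \<open>egf1 y\<close> is \<open>Q\<close> without
    its linear term, whose coefficient is \<open>1 / x 0\<close>.\<close>
  define y where "y = (\<lambda>i. if i = 1 then 0 else b_coeff x (i - 1))"
  define A where "A = Abs_fps (\<lambda>n. x n / fact n)"
  \<comment> \<open>The antiderivative of \<open>inverse A\<close> with zero constant term:
    \<open>b_coeff x (i - 1) / fact i\<close> is coefficient \<open>i - 1\<close> of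
    \<open>inverse A\<close> divided by \<open>i\<close>.\<close>
  define Q where "Q = Abs_fps (\<lambda>i. if i = 0 then 0 else b_coeff x (i - 1) / fact i)"
  define H where "H = fps_shift 1 Q"
  define S where "S = fps_shift 1 (egf1 y)"
  \<comment> \<open>Chosen so that \<open>H\<close>, which is \<open>1 / x 0 + S\<close>, factors as
    \<open>(1 - w) / x 0\<close> with \<open>w $ 0 = 0\<close>.\<close>
  define w where "w = fps_const (- x 0) * S"

  have A0: "A $ 0 = x 0" by (simp add: A_def)
  have b: "b_coeff x s = fact s * inverse A $ s" for s
    using b_coeff_conv_fps_inverse[of x, OF assms(1)] by (simp add: A_def)
  have "fps_deriv Q = inverse A"
    by (simp add: fps_eq_iff Q_def b del: of_nat_Suc)
  then have AQ: "A * fps_deriv Q = 1" using assms(1) A0 by (simp add: inverse_mult_eq_1')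
  have QH: "Q = fps_X * H" by (simp add: H_def fps_eq_iff Q_def)
  have Sy: "egf1 y = fps_X * S" by (simp add: S_def fps_eq_iff egf1_def)
  have S0: "S $ 0 = 0" by (simp add: S_def egf1_def y_def)
  have "H = fps_const (1 / x 0) * (1 - w)"
  proof (rule fps_ext)
    fix i
    show "H $ i = (fps_const (1 / x 0) * (1 - w)) $ i"
      using assms(1) A0 by (cases i) (auto simp: H_def Q_def w_def S_def egf1_def y_def b divide_inverse)
  qed
  then have invH: "inverse H = fps_const (x 0) * inverse (1 - w)"
    by (simp add: fps_inverse_mult fps_const_inverse)
  have H0: "H $ 0 \<noteq> 0" using assms(1) A0 by (simp add: H_def Q_def b)

  have "tree_sum x n = tree_sum (\<lambda>i. fps_nth_deriv i A $ 0) n"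
    by (simp add: fps_deriv_maclauren_0 A_def)
  also have "\<dots> = ((\<lambda>f. A * fps_deriv f) ^^ m) A $ 0"
    by (simp add: tree_sum_fps_nth_0[symmetric] n tree_sum_derivatives)
  \<comment> \<open>For \<open>f = A\<close> the numerator \<open>A * fps_deriv Q\<close> is 1,
    which leaves a pure power of \<open>1/Q\<close>.\<close>
  also have "\<dots> = fact m * fls_residue (fps_to_fls 1 * inverse (fps_to_fls (fps_X * H)) ^ Suc m)"
    using fps_nth_0_iterate_deriv[OF AQ, of m A] unfolding AQ by (simp add: QH)
  also have "\<dots> = fact m * (1 * inverse H ^ Suc m) $ m"
    by (simp only: fls_residue_times_inverse_power[OF H0])
  also have "(1 * inverse H ^ Suc m) $ m = (fps_const (x 0) * inverse (1 - w)) ^ Suc m $ m"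
    by (simp add: invH)
  also have "\<dots> = x 0 ^ n * (\<Sum>k=0..m. of_nat ((m + k) choose k) * (w ^ k) $ m)"
    using S0 unfolding power_mult_distrib fps_const_power
    by (simp add: fps_inverse_one_minus_power_nth w_def n del: power_Suc)
  also have "fact m * \<dots> = x 0 ^ n * (\<Sum>k=0..m. (- x 0) ^ k * bell (m + k) k y)"
  proof -
    \<comment> \<open>The factor \<open>fact m\<close> times the binomial coefficient is
      \<open>fact (m + k) / fact k\<close>, the normalization of the Bell polynomial; the
      \<open>k\<close> factors \<open>fps_X\<close> in \<open>egf1 y ^ k\<close> shift degree
      \<open>m\<close> to \<open>m + k\<close>.\<close>
    have "fact m * (of_nat ((m + k) choose k) * (w ^ k) $ m) = (- x 0) ^ k * bell (m + k) k y" for k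
    proof -
      have "(w ^ k) $ m = (- x 0) ^ k * (S ^ k) $ m"
        by (simp add: w_def power_mult_distrib fps_const_power)
      moreover have "(egf1 y ^ k) $ (m + k) = (S ^ k) $ m"
        by (simp add: Sy power_mult_distrib fps_X_power_mult_nth)
      ultimately show ?thesis
        by (simp add: bell_conv_egf1_power binomial_fact)
    qed
    then show ?thesis by (simp add: sum_distrib_left mult.left_commute[of "fact m"])
  qed
  \<comment> \<open>The additional summand \<open>k = n\<close> vanishes: \<open>egf1 y\<close> has
    order at least 2, so its \<open>n\<close>-th power has no term of degree
    \<open>2 * n - 1 = n + m\<close>.\<close>
  also have "(\<Sum>k=0..m. (- x 0) ^ k * bell (m + k) k y) = (\<Sum>k=0..n. (- x 0) ^ k * bell (n + k - 1) k y)"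
  proof -
    have "(egf1 y ^ n) $ (n + m) = (S ^ n) $ m"
      by (simp add: Sy power_mult_distrib fps_X_power_mult_nth)
    also have "\<dots> = 0" using S0 startsby_zero_power_prefix[of S n] n by simp
    finally show ?thesis by (simp add: n bell_conv_egf1_power add_ac)
  qed
  finally show ?thesis unfolding y_def .
qed

end
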